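(* Let $q$ be a prime power, let $C\subseteq\mathbb{F}_q^n$ be an $[n,k]$ code over $\mathbb{F}_q$, let $1\le d\le n$, and let $f\in\mathrm{Harm}_d(n)$. Then for any integer $r$ with $0\le r\le k$, $$Z_{C,f}^{(r)}(x,y)=\frac{1}{[r]_{q}}\sum_{j=0}^{r}\binom{r}{j}_{q}(-1)^{r-j}q^{\binom{r-j}{2}}\,Z_{C,f}(x,y;q^j).$$
   Context: Let $E=\{1,\dots,n\}$ and let $E_d$ be the set of $d$-element subsets of $E$. $\mathrm{Harm}_d(n)$ is the space of functions $f:E_d\to\mathbb{R}$ such that $\sum_{Z\in E_d,\,Y\subseteq Z}f(Z)=0$ for every $Y\in E_{d-1}$. For $X\subseteq E$ put $\widetilde f(X)=\sum_{Z\in E_d,\,Z\subseteq X}f(Z)$. An $[n,k]$ code over $\mathbb{F}_q$ is a $k$-dimensional linear subspace of $\mathbb{F}_q^n$. For a vector $\mathbf u$, $\mathrm{supp}(\mathbf u)=\{i\in E: u_i\ne 0\}$ and $\mathrm{wt}(\mathbf u)=|\mathrm{supp}(\mathbf u)|$; for a set $D$ of vectors, $\mathrm{Supp}(D)=\bigcup_{\mathbf u\in D}\mathrm{supp}(\mathbf u)$ and $\mathrm{wt}(D)=|\mathrm{Supp}(D)|$. Higher weights: $\mathcal{D}_r(C)$ is the set of $r$-dimensional linear subspaces of $C$; $A_{i,f}^{(r)}(C)=\sum_{D\in\mathcal{D}_r(C),\,\mathrm{wt}(D)=i}\widetilde f(\mathrm{Supp}(D))$; the harmonic $r$-th higher weight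 enumerator $W_{C,f}^{(r)}(x,y)=\sum_{i=0}^n A_{i,f}^{(r)}(C)x^{n-i}y^i$ equals $(xy)^dZ_{C,f}^{(r)}(x,y)$ with $Z_{C,f}^{(r)}(x,y)=\sum_{i=d}^{n-d}A_{i,f}^{(r)}(C)x^{n-i-d}y^{i-d}$. Extended weights: for a positive integer $m$, $C[q^m]=C\otimes\mathbb{F}_{q^m}\subseteq\mathbb{F}_{q^m}^n$ is the $\mathbb{F}_{q^m}$-linear span of $C$; $A_{i,f}^{q^m}(C)=\sum_{\mathbf u\in C[q^m],\,\mathrm{wt}(\mathbf u)=i}\widetilde f(\mathrm{supp}(\mathbf u))$; the harmonic $q^m$-extended weight enumerator $W_{C,f}(x,y;q^m)=\sum_{i=0}^nA_{i,f}^{q^m}(C)x^{n-i}y^i$ equals $(xy)^dZ_{C,f}(x,y;q^m)$ with $Z_{C,f}(x,y;q^m)=\sum_{i=d}^{n-d}A_{i,f}^{q^m}(C)x^{n-i-d}y^{i-d}$. Empty sums are $0$. By convention, $Z_{C,f}(x,y;q^0)=0$. For integers $a,b\ge0$, $[a,b]_q=\prod_{i=0}^{b-1}(q^a-q^i)$, $[a]_q=[a,a]_q$, and $\binom{a}{b}_q=[a,b]_q/[b]_q$ is the Gaussian binomial coefficient; $\binom{r-j}{2}$ is an ordinary binomial coefficient. *)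

theory Defs
  imports "HOL-Analysis.Cartesian_Space" "HOL-Number_Theory.Residues" "HOL-Algebra.Algebraic_Closure_Type"
begin

text \<open>
  The coordinate set \<open>E = {1,\<dots>,n}\<close> is represented by a finite type \<open>'n\<close> with
  \<open>CARD('n) = n\<close>, and \<open>\<F>\<^sub>q\<close> by a finite field type \<open>'a\<close> with \<open>CARD('a) = q\<close>.
\<close>

section \<open>Discrete harmonic functions\<close>

definition subsets_of_size :: "nat \<Rightarrow> 'n::finite set set" where
  "subsets_of_size d = {Z. card Z = d}"

text \<open>
  A function on the \<open>d\<close>-subsets is represented by a function on all subsets whose values outside
  \<open>subsets_of_size d\<close> are irrelevant: neither \<open>Harm d\<close> nor \<open>harm_ext d\<close> looks at them.
  Only \<open>d \<ge> 1\<close> is meaningful.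
\<close>

definition Harm :: "nat \<Rightarrow> ('n::finite set \<Rightarrow> real) set" where
  "Harm d = {f. \<forall>Y\<in>subsets_of_size (d - 1). (\<Sum>Z | Z \<in> subsets_of_size d \<and> Y \<subseteq> Z. f Z) = 0}"

definition harm_ext :: "nat \<Rightarrow> ('n::finite set \<Rightarrow> real) \<Rightarrow> 'n set \<Rightarrow> real" where
  "harm_ext d f S = (\<Sum>Z | Z \<in> subsets_of_size d \<and> Z \<subseteq> S. f Z)"

section \<open>Codes and supports\<close>

definition linear_code :: "nat \<Rightarrow> nat \<Rightarrow> ('a::finite_field ^ 'n::finite) set \<Rightarrow> bool" where
  "linear_code n k C \<longleftrightarrow> CARD('n) = n \<and> vec.subspace C \<and> vec.dim C = k"

definition supp :: "('b::zero ^ 'n::finite) \<Rightarrow> 'n set" where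
  "supp u = {i. u $ i \<noteq> 0}"

definition wt :: "('b::zero ^ 'n::finite) \<Rightarrow> nat" where
  "wt u = card (supp u)"

definition Supp_set :: "('b::zero ^ 'n::finite) set \<Rightarrow> 'n set" where
  "Supp_set D = (\<Union>u\<in>D. supp u)"

definition wt_set :: "('b::zero ^ 'n::finite) set \<Rightarrow> nat" where
  "wt_set D = card (Supp_set D)"

section \<open>Harmonic higher weight enumerators\<close>

definition subcodes :: "nat \<Rightarrow> ('a::finite_field ^ 'n::finite) set \<Rightarrow> ('a ^ 'n) set set" where
  "subcodes r C = {D. D \<subseteq> C \<and> vec.subspace D \<and> vec.dim D = r}"

definition higher_A ::
  "nat \<Rightarrow> ('n::finite set \<Rightarrow> real) \<Rightarrow> nat \<Rightarrow> ('a::finite_field ^ 'n) set \<Rightarrow> nat \<Rightarrow> real" where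
  "higher_A d f r C i = (\<Sum>D | D \<in> subcodes r C \<and> wt_set D = i. harm_ext d f (Supp_set D))"

text \<open>
  Polynomials in \<open>x\<close> and \<open>y\<close> are elements of \<open>\<real>[y][x]\<close>: the outer variable is \<open>x\<close>, the inner
  one is \<open>y\<close>.
\<close>

definition mono_xy :: "real \<Rightarrow> nat \<Rightarrow> nat \<Rightarrow> real poly poly" where
  "mono_xy c a b = Polynomial.monom (Polynomial.monom c b) a"  \<comment> \<open>\<open>c x\<^sup>a y\<^sup>b\<close>\<close>

text \<open>
  The sum is empty when \<open>2 * d > n\<close>; for all its indices the truncated subtractions in the
  exponents are exact.
\<close>

definition higher_Z ::
  "nat \<Rightarrow> ('n::finite set \<Rightarrow> real) \<Rightarrow> nat \<Rightarrow> ('a::finite_field ^ 'n) set \<Rightarrow> real poly poly" where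
  "higher_Z d f r C =
     (\<Sum>i = d..CARD('n) - d. mono_xy (higher_A d f r C i) (CARD('n) - i - d) (i - d))"

section \<open>Harmonic extended weight enumerators\<close>

text \<open>
  For \<open>m \<ge> 1\<close> and \<open>q = CARD('a)\<close>, the field with \<open>q^m\<close> elements is taken to be the set of roots
  of \<open>X^(q^m) - X\<close> in the algebraic closure of \<open>'a\<close>. The lemmas below confirm that this is
  a subfield with \<open>q^m\<close> elements that contains (the image of) \<open>'a\<close>.
\<close>

definition ext_field :: "nat \<Rightarrow> 'a::finite_field alg_closure set" where
  "ext_field m = {x. x ^ (CARD('a) ^ m) = x}"

lemma to_ac_in_ext_field: "to_ac (x :: 'a::finite_field) \<in> ext_field m"
  unfolding ext_field_def
  by (simp add: finite_field_power_card_power_eq_same[OF refl] flip: to_ac_power)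

lemma ext_field_0: "(0 :: 'a::finite_field alg_closure) \<in> ext_field m"
  and ext_field_1: "(1 :: 'a::finite_field alg_closure) \<in> ext_field m"
  using to_ac_in_ext_field[of "0 :: 'a" m] to_ac_in_ext_field[of "1 :: 'a" m] by simp_all

lemma ext_field_mult: "x \<in> ext_field m \<Longrightarrow> y \<in> ext_field m \<Longrightarrow> x * y \<in> ext_field m"
  by (simp add: ext_field_def power_mult_distrib)

lemma ext_field_inverse: "x \<in> ext_field m \<Longrightarrow> inverse x \<in> ext_field m"
  by (simp add: ext_field_def power_inverse)

lemma ext_field_uminus: "x \<in> ext_field m \<Longrightarrow> - x \<in> ext_field m"
  using ext_field_mult[of "to_ac (- 1)" m x] to_ac_in_ext_field[of "- 1" m] by simp

lemma of_nat_CARD_choose_eq_0: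
  assumes "0 < i" "i < CARD('a)"
  shows "of_nat (CARD('a) choose i) = (0 :: 'a::finite_field)"
proof -
  define q where "q = CARD('a)"
  have q: "q \<ge> 1"
    by (simp add: q_def Suc_le_eq)
  define p :: "'a poly" where "p = (\<Sum>j\<in>{1..<q}. Polynomial.monom (of_nat (q choose j)) j)"
  have root: "poly p x = 0" for x
  proof -
    have "(x + 1) ^ q = (\<Sum>j\<in>insert 0 (insert q {1..<q}). of_nat (q choose j) * x ^ j)"
      by (subst binomial_ring, rule sum.cong) auto
    also have "\<dots> = 1 + x ^ q + poly p x"
      using q by (simp add: p_def poly_sum poly_monom)
    finally show ?thesis
      by (simp add: q_def finite_field_power_card_eq_same)
  qed
  have "p = 0"
  proof (rule ccontr)
    assume "p \<noteq> 0"
    have "Polynomial.degree p \<le> q - 1"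
      unfolding p_def by (intro degree_sum_le) (auto intro: order.trans[OF degree_monom_le])
    moreover have "card {x. poly p x = 0} \<le> Polynomial.degree p"
      using \<open>p \<noteq> 0\<close> by (rule card_poly_roots_bound)
    moreover have "card {x. poly p x = 0} = q"
      using root by (simp add: q_def)
    ultimately show False
      using q by linarith
  qed
  hence "Polynomial.coeff p i = 0"
    by simp
  also have "Polynomial.coeff p i = (\<Sum>j\<in>{1..<q}. if j = i then of_nat (q choose j) else 0)"
    unfolding p_def Polynomial.coeff_sum by (intro sum.cong) auto
  also have "\<dots> = of_nat (q choose i)"
    using assms by (simp add: q_def)
  finally show ?thesis
    by (simp add: q_def)
qed

lemma power_CARD_add:
  fixes x y :: "'a::finite_field alg_closure"
  shows "(x + y) ^ (CARD('a) ^ m) = x ^ (CARD('a) ^ m) + y ^ (CARD('a) ^ m)"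
proof (induction m)
  case (Suc m)
  define q where "q = CARD('a)"
  have q: "q \<ge> 1"
    by (simp add: q_def Suc_le_eq)
  have "(u + v) ^ q = u ^ q + v ^ q" for u v :: "'a alg_closure"
  proof -
    have "(u + v) ^ q =
        (\<Sum>j\<in>insert 0 (insert q {1..<q}). of_nat (q choose j) * u ^ j * v ^ (q - j))"
      by (subst binomial_ring, rule sum.cong) auto
    also have "\<dots> = v ^ q + u ^ q + (\<Sum>j\<in>{1..<q}. of_nat (q choose j) * u ^ j * v ^ (q - j))"
      using q by simp
    also have "(\<Sum>j\<in>{1..<q}. of_nat (q choose j) * u ^ j * v ^ (q - j)) = 0"
    proof (intro sum.neutral ballI)
      fix j assume "j \<in> {1..<q}"
      hence "to_ac (of_nat (q choose j) :: 'a) = 0"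
        using of_nat_CARD_choose_eq_0[where 'a = 'a, of j] by (simp add: q_def)
      thus "of_nat (q choose j) * u ^ j * v ^ (q - j) = 0"
        by simp
    qed
    finally show ?thesis
      by simp
  qed
  thus ?case
    using Suc.IH by (simp add: power_mult q_def mult.commute[of "CARD('a)"])
qed simp

lemma ext_field_add: "x \<in> ext_field m \<Longrightarrow> y \<in> ext_field m \<Longrightarrow> x + y \<in> ext_field m"
  by (simp add: ext_field_def power_CARD_add)

lemma card_ext_field:
  assumes "m \<ge> 1"
  shows "card (ext_field m :: 'a::finite_field alg_closure set) = CARD('a) ^ m"
proof -
  define N where "N = CARD('a) ^ m"
  have "CARD('a) > 1"
    using card_mono[of UNIV "{0, 1 :: 'a}"] by simp
  with assms have N: "N > 1"
    unfolding N_def by (intro one_less_power) auto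
  have char: "of_nat N = (0 :: 'a alg_closure)"
  proof -
    have "CHAR('a) dvd N"
      using CHAR_dvd_CARD[where 'a = 'a] assms unfolding N_def
      by (meson dvd_trans dvd_power less_le_trans zero_less_one)
    thus ?thesis
      by (simp add: of_nat_eq_0_iff_char_dvd)
  qed
  define p :: "'a alg_closure poly" where "p = Polynomial.monom 1 N - [:0, 1:]"
  have deg: "Polynomial.degree p = N"
    unfolding p_def diff_conv_add_uminus using N
    by (subst degree_add_eq_left) (auto simp: Polynomial.degree_monom_eq)
  have lc: "Polynomial.lead_coeff p = 1"
    unfolding deg using N by (simp add: p_def coeff_pCons split: nat.split)
  have "p \<noteq> 0"
    using lc by auto
  have deriv: "pderiv p = - 1"
    by (simp add: p_def pderiv_diff pderiv_monom char pderiv_pCons one_pCons)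
  obtain A where A: "size A = N" "p = (\<Prod>x\<in>#A. [:- x, 1:])"
    using alg_closed_imp_factorization[OF \<open>p \<noteq> 0\<close>] lc deg by auto
  have "count A x \<le> 1" for x
  proof (rule ccontr)
    assume "\<not> count A x \<le> 1"
    hence "Suc (Suc 0) \<le> count A x" by simp
    hence "{#x, x#} \<subseteq># A"
      by (intro mset_subset_eqI) auto
    then obtain B where "A = {#x, x#} + B"
      by (metis subset_mset.le_iff_add)
    hence "p = [:- x, 1:] * ([:- x, 1:] * (\<Prod>x\<in>#B. [:- x, 1:]))"
      using A(2) by simp
    hence "poly (pderiv p) x = 0"
      by (simp only: pderiv_mult) simp
    thus False
      by (simp add: deriv)
  qed
  hence "A = mset_set (set_mset A)"
    by (intro multiset_eqI) (metis count_mset_set(1,3) count_greater_zero_iff finite_set_mset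
        le_neq_implies_less less_one not_in_iff)
  hence "card (set_mset A) = N"
    using A(1) by (metis size_mset_set)
  moreover have "set_mset A = ext_field m"
  proof -
    have "x \<in># A \<longleftrightarrow> poly p x = 0" for x
      unfolding A(2) by (auto simp: poly_prod_mset)
    moreover have "poly p x = 0 \<longleftrightarrow> x ^ N = x" for x
      by (simp add: p_def poly_monom)
    ultimately show ?thesis
      by (auto simp: ext_field_def N_def)
  qed
  ultimately show ?thesis
    by (simp add: N_def)
qed

definition embed_vec :: "('a::finite_field ^ 'n::finite) \<Rightarrow> 'a alg_closure ^ 'n" where
  "embed_vec u = (\<chi> i. to_ac (u $ i))"

text \<open>
  The linear span of the finite set \<open>C\<close> over the subfield \<open>ext_field m\<close> (not over the whole
  algebraic closure), written out as the set of linear combinations.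
\<close>

definition ext_code :: "nat \<Rightarrow> ('a::finite_field ^ 'n::finite) set \<Rightarrow> ('a alg_closure ^ 'n) set" where
  "ext_code m C = {(\<Sum>c\<in>C. a c *s embed_vec c) | a. \<forall>c\<in>C. a c \<in> ext_field m}"

definition extended_A ::
  "nat \<Rightarrow> ('n::finite set \<Rightarrow> real) \<Rightarrow> nat \<Rightarrow> ('a::finite_field ^ 'n) set \<Rightarrow> nat \<Rightarrow> real" where
  "extended_A d f m C i = (\<Sum>u | u \<in> ext_code m C \<and> wt u = i. harm_ext d f (supp u))"

text \<open>The value for \<open>m = 0\<close> is a convention: no field with \<open>q^0\<close> elements is involved.\<close>

definition extended_Z ::
  "nat \<Rightarrow> ('n::finite set \<Rightarrow> real) \<Rightarrow> nat \<Rightarrow> ('a::finite_field ^ 'n) set \<Rightarrow> real poly poly" where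
  "extended_Z d f m C =
     (if m = 0 then 0
      else (\<Sum>i = d..CARD('n) - d. mono_xy (extended_A d f m C i) (CARD('n) - i - d) (i - d)))"

section \<open>Gaussian binomial coefficients\<close>

definition q_bracket :: "nat \<Rightarrow> nat \<Rightarrow> nat \<Rightarrow> real" where
  "q_bracket q a b = (\<Prod>i<b. real q ^ a - real q ^ i)"

definition q_binomial :: "nat \<Rightarrow> nat \<Rightarrow> nat \<Rightarrow> real" where
  "q_binomial q a b = q_bracket q a b / q_bracket q b b"

end

theory Submission
  imports Defs
begin

text \<open>
  Both enumerators are sums over coordinate sets \<open>S\<close>: the coefficient of weight \<open>i\<close> is
  \<open>\<Sum> N(S) f~(S)\<close> over all \<open>S\<close> of size \<open>i\<close>, where \<open>f~\<close> is \<open>harm_ext d f\<close> and \<open>N(S)\<close> counts the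
  \<open>r\<close>-dimensional subcodes, respectively the extended codewords, with support exactly \<open>S\<close>. So it
  suffices to relate these two counts for each \<open>S\<close>.

  The counts become explicit when ``exactly \<open>S\<close>'' is relaxed to ``contained in \<open>S\<close>''. Let \<open>C\<^sub>S\<close>
  be the subcode of all codewords supported in \<open>S\<close>, and \<open>x = |C\<^sub>S|\<close>.

  \<^item> The number of \<open>r\<close>-dimensional subspaces of \<open>C\<^sub>S\<close>, times \<open>[r]\<^sub>q\<close>, is the number
    \<open>(x - 1) (x - q) \<dots> (x - q^(r-1))\<close> of linearly independent \<open>r\<close>-tuples in \<open>C\<^sub>S\<close>
    (\<open>card_subcodes\<close>).
  \<^item> A basis of the field with \<open>q^m\<close> elements over the field with \<open>q\<close> elements splits a word of
    the extended code into \<open>m\<close> words of \<open>C\<close>, and its support is the union of theirs. Hence \<open>x^m\<close>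
    words of the extended code are supported in \<open>S\<close> (\<open>card_ext_code_supp_subset\<close>).

  The Gaussian binomial theorem expands the first number in powers of \<open>x\<close>, that is, in terms of
  the second (\<open>prod_diff_power_eq_sum_q_binomial\<close>). A function on sets is determined by its sums
  over all subsets, so the relation descends to supports equal to \<open>S\<close>
  (\<open>num_subcodes_Supp_eq\<close>).

  The power \<open>x^0 = 1\<close> counts the zero word alone. Its support is empty and \<open>f~\<close> vanishes there
  because \<open>d \<ge> 1\<close>, which is why the convention \<open>Z(x, y; q^0) = 0\<close> is the right one.
\<close>

section \<open>The Gaussian binomial theorem\<close>

lemma q_bracket_Suc_Suc:
  "q_bracket q (Suc a) (Suc b) = (real q ^ Suc a - 1) * real q ^ b * q_bracket q a b"
proof -
  have "q_bracket q (Suc a) (Suc b) = (real q ^ Suc a - 1) * (\<Prod>i<b. real q * (real q ^ a - real q ^ i))"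
    unfolding q_bracket_def by (subst prod.lessThan_Suc_shift) (simp add: algebra_simps)
  thus ?thesis
    by (simp add: q_bracket_def prod.distrib)
qed

lemma q_bracket_self_pos:
  assumes "q \<ge> 2"
  shows "q_bracket q b b > 0"
  unfolding q_bracket_def using assms by (intro prod_pos) (auto intro!: power_strict_increasing)

lemma q_binomial_eq_0: "a < b \<Longrightarrow> q_binomial q a b = 0"
  by (auto simp: q_binomial_def q_bracket_def)

lemma q_binomial_0_right: "q_binomial q a 0 = 1"
  by (simp add: q_binomial_def q_bracket_def)

text \<open>
  The Pascal rule. All three coefficients are multiples of \<open>q_binomial q r j\<close>, and what is left
  is \<open>q^(r+1) - 1 = (q^(j+1) - 1) + q (q^r - q^j)\<close>.
\<close>

lemma q_binomial_Suc_Suc: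
  assumes "q \<ge> 2"
  shows "q_binomial q (Suc r) (Suc j) = q_binomial q r j + real q ^ Suc j * q_binomial q r (Suc j)"
proof -
  define P N where "P = q_bracket q j j" and "N = q_bracket q r j"
  define u where "u = real q ^ Suc j - 1"
  have "real q ^ Suc j > 1"
    using assms by (intro one_less_power) auto
  hence u: "u \<noteq> 0" and P: "P \<noteq> 0" and qj: "real q ^ j \<noteq> 0"
    using q_bracket_self_pos[OF assms, of j] assms by (auto simp: u_def P_def)
  have 1: "q_bracket q (Suc j) (Suc j) = u * real q ^ j * P"
    by (simp add: q_bracket_Suc_Suc u_def P_def)
  have 2: "q_bracket q (Suc r) (Suc j) = (real q ^ Suc r - 1) * real q ^ j * N"
    by (simp add: q_bracket_Suc_Suc N_def)
  have 3: "q_bracket q r (Suc j) = N * (real q ^ r - real q ^ j)"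
    by (simp add: q_bracket_def N_def)
  have "q_binomial q r j + real q ^ Suc j * q_binomial q r (Suc j) =
      N / P + real q * (N * (real q ^ r - real q ^ j)) / (u * P)"
    unfolding q_binomial_def 1 3 using qj by (simp add: N_def P_def)
  also have "\<dots> = N * (u + real q * (real q ^ r - real q ^ j)) / (u * P)"
    using u P by (simp add: field_simps)
  also have "u + real q * (real q ^ r - real q ^ j) = real q ^ Suc r - 1"
    by (simp add: u_def algebra_simps)
  also have "N * (real q ^ Suc r - 1) / (u * P) = q_binomial q (Suc r) (Suc j)"
    unfolding q_binomial_def 1 2 using qj assms by simp
  finally show ?thesis ..
qed

text \<open>
  Induction on \<open>r\<close>: multiplying by \<open>x - q^r\<close> turns the coefficients \<open>c r j\<close> into
  \<open>c r (j - 1) - q^r c r j\<close>, which is the Pascal rule once the signs and powers of \<open>q\<close> in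
  \<open>c\<close> are taken out.
\<close>

lemma prod_diff_power_eq_sum_q_binomial:
  fixes x :: real
  assumes "q \<ge> 2"
  shows "(\<Prod>i<r. x - real q ^ i) =
    (\<Sum>j = 0..r. q_binomial q r j * (-1) ^ (r - j) * real q ^ ((r - j) choose 2) * x ^ j)"
proof (induction r)
  case 0
  show ?case by (simp add: q_binomial_0_right binomial_eq_0)
next
  case (Suc r)
  define c where "c r j = q_binomial q r j * (-1) ^ (r - j) * real q ^ ((r - j) choose 2)" for r j
  have step: "c (Suc r) (Suc j) = c r j - real q ^ r * c r (Suc j)" for j
  proof (cases "j < r")
    case True
    then obtain t where t: "r = Suc (j + t)"
      using less_imp_Suc_add by blast
    have "(r - j) choose 2 = t + ((r - Suc j) choose 2)"
      by (simp add: t numeral_2_eq_2)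
    moreover have "Suc r - Suc j = Suc t" "r - j = Suc t" "r - Suc j = t"
      by (auto simp: t)
    moreover have "real q ^ r = real q ^ Suc j * real q ^ t"
      by (simp add: t power_add)
    ultimately show ?thesis
      by (simp add: c_def q_binomial_Suc_Suc[OF assms] algebra_simps power_add)
  next
    case False
    thus ?thesis
      by (simp add: c_def q_binomial_Suc_Suc[OF assms] q_binomial_eq_0)
  qed
  have zero: "c (Suc r) 0 = - (real q ^ r * c r 0)"
    by (simp add: c_def q_binomial_0_right numeral_2_eq_2 power_add)
  have top: "c r (Suc r) = 0"
    by (simp add: c_def q_binomial_eq_0)
  have "(\<Prod>i<Suc r. x - real q ^ i) = (\<Sum>j\<le>r. c r j * x ^ j) * (x - real q ^ r)"
    using Suc.IH by (simp add: c_def atMost_atLeast0)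
  also have "\<dots> = (\<Sum>j\<le>r. c r j * x ^ Suc j) - real q ^ r * (\<Sum>j\<le>Suc r. c r j * x ^ j)"
    by (simp add: top sum_distrib_left sum_distrib_right sum_subtractf algebra_simps)
  also have "\<dots> = c (Suc r) 0 + (\<Sum>j\<le>r. c (Suc r) (Suc j) * x ^ Suc j)"
    by (simp only: sum.atMost_Suc_shift[of "\<lambda>j. c r j * x ^ j"])
       (simp add: step zero sum_distrib_left sum_subtractf algebra_simps)
  also have "\<dots> = (\<Sum>j\<le>Suc r. c (Suc r) j * x ^ j)"
    by (subst sum.atMost_Suc_shift) simp
  finally show ?case
    by (simp only: c_def atMost_atLeast0)
qed

section \<open>Counting subspaces over a finite field\<close>

lemma (in vector_space) card_span_independent:
  assumes "finite (UNIV :: 'a set)" "finite B" "independent B"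
  shows "card (span B) = CARD('a) ^ card B"
proof -
  let ?\<phi> = "\<lambda>g. \<Sum>b\<in>B. scale (g b) b"
  have inj: "inj_on ?\<phi> (B \<rightarrow>\<^sub>E UNIV)"
  proof (rule inj_onI)
    fix g h assume gh: "g \<in> B \<rightarrow>\<^sub>E UNIV" "h \<in> B \<rightarrow>\<^sub>E UNIV" "?\<phi> g = ?\<phi> h"
    have "(\<Sum>b\<in>B. scale (g b - h b) b) = 0"
      using gh(3) by (simp add: scale_left_diff_distrib sum_subtractf)
    hence "\<forall>b\<in>B. g b - h b = 0"
      using independentD[OF assms(3,2) subset_refl, of "\<lambda>b. g b - h b"] by blast
    thus "g = h"
      using gh(1,2) by (auto intro: PiE_ext)
  qed
  have image: "?\<phi> ` (B \<rightarrow>\<^sub>E UNIV) = span B"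
  proof -
    have "?\<phi> g \<in> ?\<phi> ` (B \<rightarrow>\<^sub>E UNIV)" for g
      by (rule image_eqI[of _ _ "restrict g B"]) auto
    thus ?thesis
      by (auto simp: span_finite[OF assms(2)])
  qed
  have "card (span B) = card (B \<rightarrow>\<^sub>E (UNIV :: 'a set))"
    using card_image[OF inj] by (simp only: image)
  thus ?thesis
    using assms(2) by (simp add: card_PiE)
qed

definition indep_lists :: "nat \<Rightarrow> ('a::finite_field ^ 'n::finite) set \<Rightarrow> ('a ^ 'n) list set" where
  "indep_lists r V = {xs. length xs = r \<and> set xs \<subseteq> V \<and> distinct xs \<and> vec.independent (set xs)}"

lemma card_span_indep_list:
  fixes V :: "('a::finite_field ^ 'n::finite) set"
  assumes "xs \<in> indep_lists r V"
  shows "card (vec.span (set xs)) = CARD('a) ^ r"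
  using assms vec.card_span_independent[of "set xs"]
  by (auto simp: indep_lists_def distinct_card)

lemma finite_indep_lists: "finite (indep_lists r V)"
  by (rule finite_subset[OF _ finite_lists_length_eq[of UNIV r]]) (auto simp: indep_lists_def)

text \<open>
  An independent list of length \<open>r\<close> spans \<open>q^r\<close> vectors of \<open>V\<close>, and any of the others extends
  it. If \<open>r\<close> exceeds the dimension of \<open>V\<close>, both sides are \<open>0\<close>.
\<close>

lemma card_indep_lists:
  fixes V :: "('a::finite_field ^ 'n::finite) set"
  assumes "vec.subspace V"
  shows "real (card (indep_lists r V)) = (\<Prod>i<r. real (card V) - real CARD('a) ^ i)"
proof (induction r)
  case 0
  have "indep_lists 0 V = {[]}"
    by (auto simp: indep_lists_def vec.independent_empty)
  thus ?case by simp
next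
  case (Suc r)
  let ?S = "SIGMA xs:indep_lists r V. V - vec.span (set xs)"
  have "bij_betw (\<lambda>(xs, x). x # xs) ?S (indep_lists (Suc r) V)"
  proof (rule bij_betwI')
    fix ys assume "ys \<in> indep_lists (Suc r) V"
    then obtain x xs where "ys = x # xs" "(xs, x) \<in> ?S"
      by (cases ys) (auto simp: indep_lists_def vec.independent_insert)
    thus "\<exists>p\<in>?S. ys = (case p of (xs, x) \<Rightarrow> x # xs)"
      by auto
  next
    fix p assume "p \<in> ?S"
    then obtain xs x where p: "p = (xs, x)" "xs \<in> indep_lists r V" "x \<in> V" "x \<notin> vec.span (set xs)"
      by auto
    moreover from p have "vec.independent (insert x (set xs))" "x \<notin> set xs"
      by (auto simp: indep_lists_def vec.independent_insertI intro: vec.span_base)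
    ultimately show "(case p of (xs, x) \<Rightarrow> x # xs) \<in> indep_lists (Suc r) V"
      by (simp add: indep_lists_def)
  qed auto
  hence "card (indep_lists (Suc r) V) = card ?S"
    by (simp add: bij_betw_same_card)
  also have "\<dots> = (\<Sum>xs\<in>indep_lists r V. card (V - vec.span (set xs)))"
    by (subst card_SigmaI) (auto simp: finite_indep_lists)
  finally have "real (card (indep_lists (Suc r) V)) =
      (\<Sum>xs\<in>indep_lists r V. real (card (V - vec.span (set xs))))"
    by simp
  also have "\<dots> = (\<Sum>xs\<in>indep_lists r V. real (card V) - real CARD('a) ^ r)"
  proof (rule sum.cong[OF refl])
    fix xs assume xs: "xs \<in> indep_lists r V"
    hence "vec.span (set xs) \<subseteq> V"
      using assms by (auto simp: indep_lists_def intro: vec.span_minimal[THEN subsetD])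
    moreover from this have "CARD('a) ^ r \<le> card V"
      unfolding card_span_indep_list[OF xs, symmetric] by (intro card_mono) simp_all
    ultimately show "real (card (V - vec.span (set xs))) = real (card V) - real CARD('a) ^ r"
      by (simp add: card_Diff_subset of_nat_diff card_span_indep_list[OF xs])
  qed
  finally show ?case
    using Suc.IH by simp
qed

lemma card_subspace:
  fixes D :: "('a::finite_field ^ 'n::finite) set"
  assumes "vec.subspace D"
  shows "card D = CARD('a) ^ vec.dim D"
proof -
  obtain B where B: "B \<subseteq> D" "vec.independent B" "D \<subseteq> vec.span B" "card B = vec.dim D"
    using vec.basis_exists by blast
  hence "vec.span B = D"
    using assms by (simp add: vec.span_minimal subset_antisym)
  thus ?thesis
    using vec.card_span_independent[of B] B(2,4) by simp
qed

text \<open>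
  Every independent list of length \<open>r\<close> is a basis of exactly one \<open>r\<close>-dimensional subspace, and
  each of these subspaces has \<open>[r]\<^sub>q\<close> ordered bases.
\<close>

lemma card_subcodes:
  fixes V :: "('a::finite_field ^ 'n::finite) set"
  assumes "vec.subspace V"
  shows "real (card (subcodes r V)) * q_bracket CARD('a) r r =
    (\<Prod>i<r. real (card V) - real CARD('a) ^ i)"
proof -
  let ?span = "\<lambda>xs. vec.span (set xs) :: ('a ^ 'n) set"
  have fibre: "{xs \<in> indep_lists r V. ?span xs = D} = indep_lists r D" if D: "D \<in> subcodes r V" for D
  proof -
    have "?span xs = D" if "xs \<in> indep_lists r D" for xs
    proof
      show "?span xs \<subseteq> D"
        using that D by (simp add: indep_lists_def subcodes_def vec.span_minimal)
      show "D \<subseteq> ?span xs"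
        using that D by (intro vec.card_ge_dim_independent)
          (auto simp: indep_lists_def subcodes_def distinct_card)
    qed
    thus ?thesis
      using D by (auto simp: indep_lists_def subcodes_def intro: vec.span_base)
  qed
  have "?span xs \<in> subcodes r V" if "xs \<in> indep_lists r V" for xs
    using that assms vec.dim_span_eq_card_independent[of "set xs"] vec.span_minimal[of "set xs" V]
    by (auto simp: indep_lists_def subcodes_def distinct_card)
  hence "(\<Sum>xs\<in>indep_lists r V. 1 :: real) =
      (\<Sum>D\<in>subcodes r V. \<Sum>xs | xs \<in> indep_lists r V \<and> ?span xs = D. 1)"
    by (intro sum.group[symmetric]) (auto simp: finite_indep_lists)
  also have "\<dots> = (\<Sum>D\<in>subcodes r V. real (card (indep_lists r D)))"
    by (intro sum.cong refl) (simp add: fibre)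
  also have "\<dots> = (\<Sum>D\<in>subcodes r V. q_bracket CARD('a) r r)"
    by (intro sum.cong refl) (simp add: subcodes_def card_indep_lists card_subspace q_bracket_def)
  finally show ?thesis
    by (simp add: card_indep_lists[OF assms])
qed

section \<open>Counting words of the extended code\<close>

lemma vector_space_to_ac: "vector_space (\<lambda>(a :: 'a::finite_field) x. to_ac a * x)"
  by unfold_locales (simp_all add: algebra_simps)

lemma ext_field_sum:
  "(\<And>i. i \<in> I \<Longrightarrow> g i \<in> ext_field m) \<Longrightarrow> (\<Sum>i\<in>I. g i) \<in> ext_field m"
  by (induction I rule: infinite_finite_induct) (auto simp: ext_field_0 ext_field_add)

text \<open>
  The extension field is a finite vector space over the base field, and comparing \<open>q^m\<close> with
  \<open>q^(dimension)\<close> shows that its dimension is \<open>m\<close>.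
\<close>

lemma ext_field_basis:
  assumes "m \<ge> 1"
  obtains B :: "'a::finite_field alg_closure set"
  where "B \<subseteq> ext_field m" "finite B" "card B = m"
    "\<forall>g :: _ \<Rightarrow> 'a. (\<Sum>b\<in>B. to_ac (g b) * b) = 0 \<longleftrightarrow> (\<forall>b\<in>B. g b = 0)"
    "\<forall>x\<in>ext_field m. \<exists>g :: _ \<Rightarrow> 'a. x = (\<Sum>b\<in>B. to_ac (g b) * b)"
proof -
  interpret ac: vector_space "\<lambda>(a :: 'a) x. to_ac a * x"
    by (rule vector_space_to_ac)
  let ?K = "ext_field m :: 'a alg_closure set"
  have q: "CARD('a) > 1"
    using card_mono[of UNIV "{0, 1 :: 'a}"] by simp
  have K: "ac.subspace ?K"
    by (auto simp: ac.subspace_def ext_field_0 ext_field_add ext_field_mult to_ac_in_ext_field)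
  have finK: "finite ?K"
    using card_ext_field[where 'a = 'a, OF assms] by (intro card_ge_0_finite) simp
  obtain B where B: "B \<subseteq> ?K" "ac.independent B" "?K \<subseteq> ac.span B"
    by (rule ac.basis_exists[of ?K])
  have finB: "finite B"
    using B(1) finK by (rule finite_subset)
  have span: "ac.span B = ?K"
    using B K by (simp add: ac.span_minimal subset_antisym)
  have "CARD('a) ^ card B = CARD('a) ^ m"
    using ac.card_span_independent[OF _ finB B(2)] card_ext_field[where 'a = 'a, OF assms]
    by (simp add: span)
  hence "card B = m"
    using q by simp
  show thesis
  proof (rule that)
    show "\<forall>g :: _ \<Rightarrow> 'a. (\<Sum>b\<in>B. to_ac (g b) * b) = 0 \<longleftrightarrow> (\<forall>b\<in>B. g b = 0)"
      using ac.independentD[OF B(2) finB subset_refl] by auto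
    show "\<forall>x\<in>?K. \<exists>g :: _ \<Rightarrow> 'a. x = (\<Sum>b\<in>B. to_ac (g b) * b)"
      unfolding span[symmetric] ac.span_finite[OF finB] by auto
  qed fact+
qed

definition shortened :: "'n::finite set \<Rightarrow> ('a::finite_field ^ 'n) set \<Rightarrow> ('a ^ 'n) set" where
  "shortened S C = {c \<in> C. supp c \<subseteq> S}"

lemma subspace_shortened:
  assumes "vec.subspace C"
  shows "vec.subspace (shortened S C)"
proof -
  have "shortened S C = {c \<in> C. \<forall>i. i \<notin> S \<longrightarrow> c $ i = 0}"
    by (auto simp: shortened_def supp_def)
  thus ?thesis
    using assms by (simp add: vec.subspace_def)
qed

text \<open>
  For a basis \<open>B\<close> of the extension field, \<open>g \<mapsto> \<Sum>b\<in>B. b g(b)\<close> is a bijection from the families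
  \<open>B \<rightarrow> C\<close> onto the extended code. By independence of \<open>B\<close>, a coordinate of the image vanishes
  only if it vanishes in each \<open>g(b)\<close>, so words supported in \<open>S\<close> correspond to families in the
  shortened code.
\<close>

lemma
  fixes C :: "('a::finite_field ^ 'n::finite) set"
  assumes C: "vec.subspace C" and m: "m \<ge> 1"
  shows finite_ext_code: "finite (ext_code m C)"
    and card_ext_code_supp_subset:
      "card {u \<in> ext_code m C. supp u \<subseteq> S} = card (shortened S C) ^ m"
proof -
  obtain B :: "'a alg_closure set" where B: "B \<subseteq> ext_field m" "finite B" "card B = m"
    and indep: "\<forall>g :: _ \<Rightarrow> 'a. (\<Sum>b\<in>B. to_ac (g b) * b) = 0 \<longleftrightarrow> (\<forall>b\<in>B. g b = 0)"
    and gen: "\<forall>x\<in>ext_field m. \<exists>g :: _ \<Rightarrow> 'a. x = (\<Sum>b\<in>B. to_ac (g b) * b)"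
    by (rule ext_field_basis[OF m])
  define \<Phi> :: "('a alg_closure \<Rightarrow> 'a ^ 'n) \<Rightarrow> 'a alg_closure ^ 'n"
    where "\<Phi> g = (\<Sum>b\<in>B. b *s embed_vec (g b))" for g
  have nth: "\<Phi> g $ i = (\<Sum>b\<in>B. to_ac (g b $ i) * b)" for g i
    by (simp add: \<Phi>_def embed_vec_def mult.commute)
  have supp: "supp (\<Phi> g) \<subseteq> S \<longleftrightarrow> (\<forall>b\<in>B. supp (g b) \<subseteq> S)" for g S
    unfolding supp_def nth indep[rule_format] by auto
  have inj: "inj_on \<Phi> (B \<rightarrow>\<^sub>E C')" for C'
  proof (rule inj_onI)
    fix g h assume gh: "g \<in> B \<rightarrow>\<^sub>E C'" "h \<in> B \<rightarrow>\<^sub>E C'" "\<Phi> g = \<Phi> h"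
    have "(\<Sum>b\<in>B. to_ac (g b $ i - h b $ i) * b) = 0" for i
      using arg_cong[OF gh(3), of "\<lambda>u. u $ i"]
      by (simp add: nth to_ac_diff sum_subtractf algebra_simps)
    hence "g b $ i - h b $ i = 0" if "b \<in> B" for b i
      using that spec[OF indep, of "\<lambda>b. g b $ i - h b $ i"] by simp
    hence "g b = h b" if "b \<in> B" for b
      using that by (simp add: vec_eq_iff)
    thus "g = h"
      using gh(1,2) by (auto intro: PiE_ext)
  qed
  have image: "\<Phi> ` (B \<rightarrow>\<^sub>E C) = ext_code m C"
  proof (intro subset_antisym subsetI)
    fix u assume "u \<in> \<Phi> ` (B \<rightarrow>\<^sub>E C)"
    then obtain g where g: "g \<in> B \<rightarrow>\<^sub>E C" "u = \<Phi> g"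
      by blast
    \<comment> \<open>Collect the basis elements that carry the same codeword.\<close>
    have "u = (\<Sum>c\<in>C. \<Sum>b | b \<in> B \<and> g b = c. b *s embed_vec (g b))"
      unfolding g(2) \<Phi>_def using B(2) g(1) by (intro sum.group[symmetric]) auto
    also have "\<dots> = (\<Sum>c\<in>C. (\<Sum>b | b \<in> B \<and> g b = c. b) *s embed_vec c)"
      by (intro sum.cong refl) (simp add: vec.scale_sum_left)
    finally show "u \<in> ext_code m C"
      unfolding ext_code_def using B(1)
      by (auto intro!: exI[of _ "\<lambda>c. \<Sum>b | b \<in> B \<and> g b = c. b"] ext_field_sum)
  next
    fix u assume "u \<in> ext_code m C"
    then obtain a where a: "\<forall>c\<in>C. a c \<in> ext_field m" and u: "u = (\<Sum>c\<in>C. a c *s embed_vec c)"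
      by (auto simp: ext_code_def)
    have "\<forall>c\<in>C. \<exists>h :: _ \<Rightarrow> 'a. a c = (\<Sum>b\<in>B. to_ac (h b) * b)"
      using a gen by blast
    then obtain h :: "_ \<Rightarrow> _ \<Rightarrow> 'a" where h: "\<And>c. c \<in> C \<Longrightarrow> a c = (\<Sum>b\<in>B. to_ac (h c b) * b)"
      by metis
    \<comment> \<open>Expand each coefficient in the basis and collect the codewords that go with each basis element.\<close>
    define g where "g = restrict (\<lambda>b. \<Sum>c\<in>C. h c b *s c) B"
    have "u $ i = \<Phi> g $ i" for i
    proof -
      have "u $ i = (\<Sum>c\<in>C. \<Sum>b\<in>B. to_ac (h c b) * b * to_ac (c $ i))"
        by (simp add: u h embed_vec_def sum_distrib_right)
      also have "\<dots> = (\<Sum>b\<in>B. \<Sum>c\<in>C. to_ac (h c b) * b * to_ac (c $ i))"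
        by (rule sum.swap)
      also have "\<dots> = \<Phi> g $ i"
        unfolding nth by (intro sum.cong refl)
          (simp add: g_def to_ac_sum sum_distrib_left sum_distrib_right mult_ac)
      finally show ?thesis .
    qed
    moreover have "g \<in> B \<rightarrow>\<^sub>E C"
      unfolding g_def using C by (auto intro!: vec.subspace_sum vec.subspace_scale)
    ultimately show "u \<in> \<Phi> ` (B \<rightarrow>\<^sub>E C)"
      by (auto simp: vec_eq_iff)
  qed
  show "finite (ext_code m C)"
    unfolding image[symmetric] using B(2) by (intro finite_imageI finite_PiE) auto
  have "{u \<in> ext_code m C. supp u \<subseteq> S} = \<Phi> ` {g \<in> B \<rightarrow>\<^sub>E C. supp (\<Phi> g) \<subseteq> S}"
    unfolding image[symmetric] by blast
  also have "{g \<in> B \<rightarrow>\<^sub>E C. supp (\<Phi> g) \<subseteq> S} = B \<rightarrow>\<^sub>E shortened S C"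
    by (simp only: set_eq_iff PiE_iff shortened_def mem_Collect_eq supp) blast
  finally have "{u \<in> ext_code m C. supp u \<subseteq> S} = \<Phi> ` (B \<rightarrow>\<^sub>E shortened S C)" .
  hence "card {u \<in> ext_code m C. supp u \<subseteq> S} = card (B \<rightarrow>\<^sub>E shortened S C)"
    by (simp add: card_image[OF inj])
  thus "card {u \<in> ext_code m C. supp u \<subseteq> S} = card (shortened S C) ^ m"
    using B(2,3) by (simp add: card_PiE)
qed

section \<open>From support contained in a set to support equal to it\<close>

text \<open>
  The uniqueness half of Moebius inversion on the subset lattice; it lets one compare two counts
  without writing down the inversion formula.
\<close>

lemma eq_if_subset_sums_eq:
  fixes a b :: "'n set \<Rightarrow> 'c::cancel_comm_monoid_add"
  assumes "\<And>S. finite S \<Longrightarrow> (\<Sum>T\<in>Pow S. a T) = (\<Sum>T\<in>Pow S. b T)" "finite S"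
  shows "a S = b S"
  using assms(2)
proof (induction S rule: finite_psubset_induct)
  case (psubset S)
  have "Pow S = insert S {T. T \<subset> S}"
    by auto
  moreover have fin: "finite {T. T \<subset> S}"
    using psubset(1) by (auto intro: finite_subset[of _ "Pow S"])
  moreover have "(\<Sum>T | T \<subset> S. a T) = (\<Sum>T | T \<subset> S. b T)"
    using psubset.IH by (intro sum.cong) auto
  ultimately show ?case
    using assms(1)[OF psubset(1)] by simp
qed

lemma sum_card_fibres_subset:
  fixes s :: "'u \<Rightarrow> 'n::finite set"
  assumes "finite A"
  shows "(\<Sum>T\<in>Pow S. real (card {x \<in> A. s x = T})) = real (card {x \<in> A. s x \<subseteq> S})"
proof -
  have "(\<Sum>x\<in>{x \<in> A. s x \<subseteq> S}. 1 :: real) =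
      (\<Sum>T\<in>Pow S. \<Sum>x | x \<in> {x \<in> A. s x \<subseteq> S} \<and> s x = T. 1)"
    using assms by (intro sum.group[symmetric]) auto
  also have "\<dots> = (\<Sum>T\<in>Pow S. real (card {x \<in> A. s x = T}))"
  proof (intro sum.cong refl)
    fix T assume "T \<in> Pow S"
    hence "{x. x \<in> {x \<in> A. s x \<subseteq> S} \<and> s x = T} = {x \<in> A. s x = T}"
      by auto
    thus "(\<Sum>x | x \<in> {x \<in> A. s x \<subseteq> S} \<and> s x = T. 1) = real (card {x \<in> A. s x = T})"
      by simp
  qed
  finally show ?thesis by simp
qed

lemma sum_by_fibres_of_card:
  fixes s :: "'u \<Rightarrow> 'n::finite set" and g :: "'n set \<Rightarrow> real"
  assumes "finite A"
  shows "(\<Sum>x | x \<in> A \<and> card (s x) = i. g (s x)) =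
    (\<Sum>S | card S = i. real (card {x \<in> A. s x = S}) * g S)"
proof -
  have "(\<Sum>x\<in>{x \<in> A. card (s x) = i}. g (s x)) =
      (\<Sum>S\<in>{S. card S = i}. \<Sum>x | x \<in> {x \<in> A. card (s x) = i} \<and> s x = S. g (s x))"
    using assms by (intro sum.group[symmetric]) auto
  also have "\<dots> = (\<Sum>S | card S = i. real (card {x \<in> A. s x = S}) * g S)"
  proof (intro sum.cong refl)
    fix S assume "S \<in> {S :: 'n set. card S = i}"
    hence "{x. x \<in> {x \<in> A. card (s x) = i} \<and> s x = S} = {x \<in> A. s x = S}"
      by auto
    thus "(\<Sum>x | x \<in> {x \<in> A. card (s x) = i} \<and> s x = S. g (s x)) =
        real (card {x \<in> A. s x = S}) * g S"
      by simp
  qed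
  finally show ?thesis .
qed

definition num_subcodes_Supp :: "nat \<Rightarrow> ('a::finite_field ^ 'n::finite) set \<Rightarrow> 'n set \<Rightarrow> real" where
  "num_subcodes_Supp r C S = real (card {D \<in> subcodes r C. Supp_set D = S})"

text \<open>
  For \<open>m = 0\<close> the function counts the words of the zero code. The set \<open>ext_code 0 C\<close> does not
  serve here: \<open>ext_field 0\<close> is the whole algebraic closure, since \<open>x^(q^0) = x\<close> holds everywhere.
  With this choice the sum over the subsets of \<open>S\<close> is \<open>|C\<^sub>S|^m\<close> for every \<open>m\<close>.
\<close>

definition num_ext_words_supp :: "nat \<Rightarrow> ('a::finite_field ^ 'n::finite) set \<Rightarrow> 'n set \<Rightarrow> real" where
  "num_ext_words_supp m C S =
     (if m = 0 then of_bool (S = {}) else real (card {u \<in> ext_code m C. supp u = S}))"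

lemma sum_num_ext_words_supp:
  fixes C :: "('a::finite_field ^ 'n::finite) set"
  assumes "vec.subspace C"
  shows "(\<Sum>T\<in>Pow S. num_ext_words_supp m C T) = real (card (shortened S C)) ^ m"
proof (cases "m = 0")
  case True
  have "(\<Sum>T\<in>Pow S. if T = {} then 1 else 0 :: real) = 1"
    by (subst sum.delta) auto
  thus ?thesis
    using True by (simp add: num_ext_words_supp_def of_bool_def)
next
  case False
  hence "(\<Sum>T\<in>Pow S. num_ext_words_supp m C T) = real (card {u \<in> ext_code m C. supp u \<subseteq> S})"
    using finite_ext_code[OF assms] by (simp add: num_ext_words_supp_def sum_card_fibres_subset)
  thus ?thesis
    using False by (simp add: card_ext_code_supp_subset[OF assms])
qed

lemma sum_num_subcodes_Supp:
  fixes C :: "('a::finite_field ^ 'n::finite) set"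
  assumes "vec.subspace C"
  shows "(\<Sum>T\<in>Pow S. num_subcodes_Supp r C T) * q_bracket CARD('a) r r =
    (\<Prod>i<r. real (card (shortened S C)) - real CARD('a) ^ i)"
proof -
  have "{D \<in> subcodes r C. Supp_set D \<subseteq> S} = subcodes r (shortened S C)"
    by (auto simp: subcodes_def Supp_set_def shortened_def)
  thus ?thesis
    using card_subcodes[OF subspace_shortened[OF assms], of r S]
    by (simp add: num_subcodes_Supp_def sum_card_fibres_subset)
qed

text \<open>
  The theorem for a single support \<open>S\<close>. Summed over all subsets of \<open>S\<close> it is the Gaussian
  binomial theorem at \<open>x = |C\<^sub>S|\<close>, and these sums determine both sides.
\<close>

lemma num_subcodes_Supp_eq:
  fixes C :: "('a::finite_field ^ 'n::finite) set"
  assumes "vec.subspace C" "CARD('a) = q"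
  shows "num_subcodes_Supp r C S = 1 / q_bracket q r r *
    (\<Sum>j = 0..r. q_binomial q r j * (-1) ^ (r - j) * real q ^ ((r - j) choose 2) *
       num_ext_words_supp j C S)"
proof -
  let ?c = "\<lambda>j. q_binomial q r j * (-1) ^ (r - j) * real q ^ ((r - j) choose 2)"
  have q: "q \<ge> 2"
    using card_mono[of UNIV "{0, 1 :: 'a}"] assms(2) by simp
  show ?thesis
  proof (rule eq_if_subset_sums_eq[where b =
        "\<lambda>S. 1 / q_bracket q r r * (\<Sum>j = 0..r. ?c j * num_ext_words_supp j C S)"])
    fix S :: "'n set"
    have "(\<Sum>T\<in>Pow S. 1 / q_bracket q r r * (\<Sum>j = 0..r. ?c j * num_ext_words_supp j C T)) =
        1 / q_bracket q r r * (\<Sum>j = 0..r. ?c j * (\<Sum>T\<in>Pow S. num_ext_words_supp j C T))"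
      by (simp only: sum_distrib_left, subst sum.swap) simp
    also have "\<dots> = 1 / q_bracket q r r * (\<Prod>i<r. real (card (shortened S C)) - real q ^ i)"
      by (simp add: sum_num_ext_words_supp[OF assms(1)] prod_diff_power_eq_sum_q_binomial[OF q])
    also have "\<dots> = (\<Sum>T\<in>Pow S. num_subcodes_Supp r C T)"
      using sum_num_subcodes_Supp[OF assms(1), of r S] q_bracket_self_pos[OF q, of r]
      by (simp add: assms(2) field_simps)
    finally show "(\<Sum>T\<in>Pow S. num_subcodes_Supp r C T) =
      (\<Sum>T\<in>Pow S. 1 / q_bracket q r r * (\<Sum>j = 0..r. ?c j * num_ext_words_supp j C T))" ..
  qed simp
qed

section \<open>Passing to the enumerators\<close>

lemma harm_ext_empty: "d \<ge> 1 \<Longrightarrow> harm_ext d f {} = 0"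
  by (auto simp: harm_ext_def subsets_of_size_def intro!: sum.neutral)

lemma higher_A_eq:
  "higher_A d f r C i = (\<Sum>S | card S = i. num_subcodes_Supp r C S * harm_ext d f S)"
  unfolding higher_A_def wt_set_def num_subcodes_Supp_def
  by (rule sum_by_fibres_of_card) simp

text \<open>
  At \<open>m = 0\<close> the only support is the empty set, to which \<open>harm_ext d f\<close> gives weight \<open>0\<close>. This
  is where the convention for \<open>q^0\<close> enters.
\<close>

lemma weighted_num_ext_words_supp:
  fixes C :: "('a::finite_field ^ 'n::finite) set"
  assumes "vec.subspace C" "d \<ge> 1"
  shows "(\<Sum>S | card S = i. num_ext_words_supp m C S * harm_ext d f S) =
    (if m = 0 then 0 else extended_A d f m C i)"
proof (cases "m = 0")
  case True
  thus ?thesis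
    using harm_ext_empty[OF assms(2), of f] by (auto simp: num_ext_words_supp_def intro!: sum.neutral)
next
  case False
  hence "finite (ext_code m C)"
    using assms(1) by (simp add: finite_ext_code)
  thus ?thesis
    using False unfolding extended_A_def wt_def num_ext_words_supp_def
    by (simp add: sum_by_fibres_of_card)
qed

lemma mono_xy_add: "mono_xy (x + y) a b = mono_xy x a b + mono_xy y a b"
  by (simp add: mono_xy_def add_monom)

lemma mono_xy_0: "mono_xy 0 a b = 0"
  by (simp add: mono_xy_def)

lemma mono_xy_sum: "mono_xy (\<Sum>j\<in>J. g j) a b = (\<Sum>j\<in>J. mono_xy (g j) a b)"
  by (induction J rule: infinite_finite_induct) (auto simp: mono_xy_add mono_xy_0)

lemma smult_mono_xy: "Polynomial.smult [:c:] (mono_xy x a b) = mono_xy (c * x) a b"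
  by (simp add: mono_xy_def Polynomial.smult_monom)

lemma smult_sum_right: "Polynomial.smult c (\<Sum>i\<in>I. p i) = (\<Sum>i\<in>I. Polynomial.smult c (p i))"
  by (induction I rule: infinite_finite_induct) (auto simp: smult_add_right)

theorem theorem3p6:
  fixes C :: "('a::finite_field ^ 'n::finite) set"
    and f :: "'n set \<Rightarrow> real"
    and q n k d r :: nat
  assumes "CARD('a) = q"
    and "linear_code n k C"
    and "1 \<le> d" and "d \<le> n"
    and "f \<in> Harm d"
    and "r \<le> k"
  shows "higher_Z d f r C =
    Polynomial.smult [:1 / q_bracket q r r:]
      (\<Sum>j = 0..r. Polynomial.smult
         [:q_binomial q r j * (-1) ^ (r - j) * real q ^ ((r - j) choose 2):]
         (extended_Z d f j C))"
proof -
  define c where "c j = q_binomial q r j * (-1) ^ (r - j) * real q ^ ((r - j) choose 2)" for j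
  define w where "w = 1 / q_bracket q r r"
  define E where "E j i = (if j = 0 then 0 else extended_A d f j C i)" for j i
  have C: "vec.subspace C"
    using assms(2) by (simp add: linear_code_def)
  have A: "higher_A d f r C i = w * (\<Sum>j = 0..r. c j * E j i)" for i
  proof -
    have "higher_A d f r C i =
        (\<Sum>S | card S = i. \<Sum>j = 0..r. w * (c j * (num_ext_words_supp j C S * harm_ext d f S)))"
      unfolding higher_A_eq num_subcodes_Supp_eq[OF C assms(1)]
      by (simp add: c_def w_def sum_distrib_left sum_distrib_right mult.assoc)
    also have "\<dots> = w * (\<Sum>j = 0..r. c j * (\<Sum>S | card S = i. num_ext_words_supp j C S * harm_ext d f S))"
      by (subst sum.swap) (simp add: sum_distrib_left)
    finally show ?thesis
      by (simp add: weighted_num_ext_words_supp[OF C assms(3)] E_def)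
  qed
  have Z: "extended_Z d f j C =
      (\<Sum>i = d..CARD('n) - d. mono_xy (E j i) (CARD('n) - i - d) (i - d))" for j
    by (simp add: extended_Z_def E_def mono_xy_0)
  show ?thesis
    unfolding c_def[symmetric] w_def[symmetric] Z higher_Z_def A
    by (simp only: smult_sum_right smult_mono_xy mono_xy_sum sum_distrib_left, rule sum.swap)
qed

end
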